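(* Consider the excludable binary public project problem with $n$ agents whose valuations are drawn i.i.d. from a continuous distribution on $[0,1]$ with differentiable density $f$, and consider the family of largest unanimous mechanisms. (i) ($n=2$.) If $f$ is log-concave, then the serial cost sharing mechanism maximizes the expected number of consumers among largest unanimous mechanisms. If $f$ is log-concave and welfare-concave, then the serial cost sharing mechanism maximizes the expected agents' welfare among largest unanimous mechanisms. (ii) ($n=3$.) If $f$ is log-concave and nonincreasing, then the serial cost sharing mechanism maximizes the expected number of consumers among largest unanimous mechanisms. If $f$ is log-concave, nonincreasing and welfare-concave, then the serial cost sharing mechanism maximizes the expected agents' welfare among largest unanimous mechanisms.
   Context: Model. There are $n$ agents; the project costs $1$. Agent $i$ has valuation $v_i\in[0,1]$; the $v_i$ are i.i.d. with density $f$. The project is excludable: the outcome specifies a set of consumers (the project is built if and only if this set is nonempty) and payments $p_i\ge0$, with $\sum_i p_i=1$ if built and all $p_i=0$ otherwise. Agent $i$'s utility is $v_i-p_i$ if she is a consumer and $0$ otherwise. The expected number of consumers and the expected agents' welfare (expected sum of utilities) are computed under truthful reporting. Largest unanimous mechanism. For every nonempty coalition $S\subseteq\{1,\dots,n\}$ there is a constant cost share vector $(c_{S,i})_{i\in S}$ with $c_{S,i}\ge 0$ and $\sum_{i\in S}c_{S,i}=1$, such that $c_{S,i}\ge c_{T,i}$ whenever $i\in S\subsetneq T$. Coalition $S$ unanimously approves its cost share vector if and only if $v_i\ge c_{S,i}$ for all $i\in S$. The mechanism picks the largest coalition $S^*$ whose cost share vector is unanimously approved (it is unique if one exists). If $S^*$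 exists, the project is built, the consumers are exactly the agents in $S^*$, and each $i\in S^*$ pays $c_{S^*,i}$ (other agents pay $0$). If no such coalition exists, the project is not built. Serial cost sharing mechanism: the largest unanimous mechanism with $c_{S,i}=1/|S|$ for all nonempty $S$ and all $i\in S$. Log-concave: $\log f(x)$ is concave in $x$ (with $\log 0=-\infty$). Welfare-concave: the function $$w(c)=\frac{\int_c^1 (x-c)f(x)\,dx}{\int_c^1 f(x)\,dx}$$ is concave in $c$ on the set of $c\in[0,1]$ where $\int_c^1 f(x)\,dx>0$. *)

theory Defs
  imports "HOL-Analysis.Analysis"
begin

section \<open>Outcomes of the excludable public project\<close>

text \<open>Agents are the numbers \<open>1, \<dots>, n\<close>, and the project is built iff there is at least one
  consumer. A mechanism maps the reported valuation profile to an outcome.\<close>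

type_synonym profile = "nat \<Rightarrow> real"

record outcome =
  consumers :: "nat set"
  payment :: "nat \<Rightarrow> real"

type_synonym mechanism = "profile \<Rightarrow> outcome"

definition utility :: "profile \<Rightarrow> outcome \<Rightarrow> nat \<Rightarrow> real" where
  "utility v x i = (if i \<in> consumers x then v i - payment x i else 0)"


section \<open>Largest unanimous mechanisms\<close>

definition coalition :: "nat \<Rightarrow> nat set \<Rightarrow> bool" where
  "coalition n S \<longleftrightarrow> S \<subseteq> {1..n} \<and> S \<noteq> {}"

definition valid_cost_shares :: "nat \<Rightarrow> (nat set \<Rightarrow> nat \<Rightarrow> real) \<Rightarrow> bool" where
  "valid_cost_shares n c \<longleftrightarrow>
     (\<forall>S. coalition n S \<longrightarrow> (\<forall>i\<in>S. c S i \<ge> 0) \<and> (\<Sum>i\<in>S. c S i) = 1) \<and>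
     (\<forall>S T. coalition n S \<and> coalition n T \<and> S \<subset> T \<longrightarrow> (\<forall>i\<in>S. c S i \<ge> c T i))"

definition approved :: "nat \<Rightarrow> (nat set \<Rightarrow> nat \<Rightarrow> real) \<Rightarrow> profile \<Rightarrow> nat set \<Rightarrow> bool" where
  "approved n c v S \<longleftrightarrow> coalition n S \<and> (\<forall>i\<in>S. v i \<ge> c S i)"

text \<open>\<open>GREATEST\<close> refers to set inclusion; the lemmas below show that this is also the unique
  approved coalition of largest cardinality.\<close>

definition largest_approved :: "nat \<Rightarrow> (nat set \<Rightarrow> nat \<Rightarrow> real) \<Rightarrow> profile \<Rightarrow> nat set" where
  "largest_approved n c v = (GREATEST S. approved n c v S)"

definition unanimous_mechanism :: "nat \<Rightarrow> (nat set \<Rightarrow> nat \<Rightarrow> real) \<Rightarrow> mechanism" where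
  "unanimous_mechanism n c v =
     (if \<exists>S. approved n c v S
      then let S = largest_approved n c v
           in \<lparr>consumers = S, payment = (\<lambda>i. if i \<in> S then c S i else 0)\<rparr>
      else \<lparr>consumers = {}, payment = (\<lambda>_. 0)\<rparr>)"

definition largest_unanimous :: "nat \<Rightarrow> mechanism \<Rightarrow> bool" where
  "largest_unanimous n m \<longleftrightarrow> (\<exists>c. valid_cost_shares n c \<and> m = unanimous_mechanism n c)"

definition serial_cost_sharing :: "nat \<Rightarrow> mechanism" where
  "serial_cost_sharing n = unanimous_mechanism n (\<lambda>S i. 1 / real (card S))"

lemma approved_Un:
  assumes c: "valid_cost_shares n c" and S: "approved n c v S" and T: "approved n c v T"
  shows "approved n c v (S \<union> T)"
proof -
  have co: "coalition n (S \<union> T)"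
    using S T by (auto simp: approved_def coalition_def)
  have "c (S \<union> T) i \<le> v i" if "approved n c v A" "A \<subseteq> S \<union> T" "i \<in> A" for A i
  proof (cases "A = S \<union> T")
    case False
    then have "c A i \<ge> c (S \<union> T) i"
      using c co that unfolding valid_cost_shares_def approved_def by blast
    then show ?thesis using that by (force simp: approved_def)
  qed (use that in \<open>auto simp: approved_def\<close>)
  then show ?thesis using S T co by (auto simp: approved_def)
qed

lemma largest_approved:
  assumes c: "valid_cost_shares n c" and ex: "\<exists>S. approved n c v S"
  shows "approved n c v (largest_approved n c v)"
    and "approved n c v T \<Longrightarrow> T \<subseteq> largest_approved n c v"
proof -
  let ?A = "{S. approved n c v S}"
  have fin: "finite ?A"
    by (rule finite_subset[of _ "Pow {1..n}"]) (auto simp: approved_def coalition_def)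
  have "approved n c v (\<Union>B)" if "finite B" "B \<noteq> {}" "B \<subseteq> ?A" for B
    using that by (induction rule: finite_ne_induct) (auto intro: approved_Un[OF c])
  then have U: "approved n c v (\<Union>?A)" using fin ex by blast
  have eq: "largest_approved n c v = \<Union>?A"
    unfolding largest_approved_def by (rule Greatest_equality) (use U in auto)
  show "approved n c v (largest_approved n c v)" using U eq by simp
  show "T \<subseteq> largest_approved n c v" if "approved n c v T" using that eq by auto
qed

lemma largest_approved_card:
  assumes c: "valid_cost_shares n c" and T: "approved n c v T"
    and max: "\<And>S. approved n c v S \<Longrightarrow> card S \<le> card T"
  shows "T = largest_approved n c v"
proof -
  have ex: "\<exists>S. approved n c v S" using T by blast
  note L = largest_approved[OF c ex]
  have "finite (largest_approved n c v)"
    using L(1) by (auto simp: approved_def coalition_def intro: finite_subset)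
  then show ?thesis using card_seteq L(2)[OF T] max[OF L(1)] by blast
qed


section \<open>Valuation distribution and expected performance\<close>

text \<open>Only the values of the density on \<open>{0..1}\<close> matter.\<close>

definition unit_density :: "(real \<Rightarrow> real) \<Rightarrow> bool" where
  "unit_density f \<longleftrightarrow> (\<forall>x\<in>{0..1}. f x \<ge> 0) \<and> (LINT x:{0..1}|lborel. f x) = 1"

definition valuation_measure :: "(real \<Rightarrow> real) \<Rightarrow> real measure" where
  "valuation_measure f = density lborel (\<lambda>x. ennreal (indicator {0..1} x * f x))"

definition profile_measure :: "nat \<Rightarrow> (real \<Rightarrow> real) \<Rightarrow> profile measure" where
  "profile_measure n f = (\<Pi>\<^sub>M i\<in>{1..n}. valuation_measure f)"

definition expected_consumers :: "nat \<Rightarrow> (real \<Rightarrow> real) \<Rightarrow> mechanism \<Rightarrow> real" where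
  "expected_consumers n f m = (\<integral>v. real (card (consumers (m v))) \<partial>profile_measure n f)"

definition expected_welfare :: "nat \<Rightarrow> (real \<Rightarrow> real) \<Rightarrow> mechanism \<Rightarrow> real" where
  "expected_welfare n f m = (\<integral>v. (\<Sum>i\<in>{1..n}. utility v (m v) i) \<partial>profile_measure n f)"


section \<open>Conditions on the density\<close>

text \<open>The logarithm with the convention \<open>log 0 = -\<infinity>\<close> (HOL's \<open>ln\<close> is total on the reals).\<close>

definition log_ext :: "real \<Rightarrow> ereal" where
  "log_ext y = (if y > 0 then ereal (ln y) else -\<infinity>)"

definition log_concave :: "(real \<Rightarrow> real) \<Rightarrow> bool" where
  "log_concave f \<longleftrightarrow>
     (\<forall>x\<in>{0..1}. \<forall>y\<in>{0..1}. \<forall>t\<in>{0<..<1}.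
        log_ext (f ((1 - t) * x + t * y)) \<ge> ereal (1 - t) * log_ext (f x) + ereal t * log_ext (f y))"

definition conditional_welfare :: "(real \<Rightarrow> real) \<Rightarrow> real \<Rightarrow> real" where
  "conditional_welfare f c =
     (LINT x:{c..1}|lborel. (x - c) * f x) / (LINT x:{c..1}|lborel. f x)"

definition welfare_concave :: "(real \<Rightarrow> real) \<Rightarrow> bool" where
  "welfare_concave f \<longleftrightarrow>
     concave_on {c \<in> {0..1}. (LINT x:{c..1}|lborel. f x) > 0} (conditional_welfare f)"

end

theory Submission
  imports Defs "HOL-Probability.Probability"
begin

text \<open>Let \<open>G\<close> be the survival function of \<open>f\<close>. Almost surely nobody pays the full cost \<open>1\<close> alone, so for
  \<open>n \<le> 3\<close> only the grand coalition \<open>N\<close> and the coalitions \<open>N - {k}\<close> matter, the latter being chosen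
  iff approved by their members while \<open>v k < c N k\<close>. Hence, with \<open>u = 1\<close> (consumers) or \<open>u\<close> the
  conditional welfare, the objective equals \<open>V N + (\<Sum>k\<in>N. (1 - G (c N k)) * V (N - {k}))\<close>, where
  \<open>V S = (\<Prod>i\<in>S. G (c S i)) * (\<Sum>i\<in>S. u (c S i))\<close>. Log-concavity of \<open>f\<close> makes the hazard rate \<open>f / G\<close>
  nondecreasing and so \<open>G\<close> log-concave; by Jensen's inequality every \<open>V S\<close> is largest at equal shares.
  If \<open>f\<close> is nonincreasing, \<open>G\<close> is convex, and equal shares also maximize \<open>\<Sum>k\<in>N. 1 - G (c N k)\<close>.\<close>

section \<open>The survival function of a log-concave density\<close>

definition survival :: "(real \<Rightarrow> real) \<Rightarrow> real \<Rightarrow> real" where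
  "survival f c = (LINT x:{c..1}|lborel. f x)"

lemma convex_on_congI:
  assumes "convex_on A g" and "\<And>x. x \<in> A \<Longrightarrow> f x = g x"
  shows "convex_on A f"
  using assms by (auto simp: convex_on_def convex_def)

locale unit_interval_density =
  fixes f :: "real \<Rightarrow> real"
  assumes unit_density: "unit_density f"
    and continuous: "continuous_on {0..1} f"
begin

lemma nonneg: "x \<in> {0..1} \<Longrightarrow> 0 \<le> f x"
  using unit_density by (auto simp: unit_density_def)

lemma survival_0: "survival f 0 = 1"
  using unit_density by (simp add: unit_density_def survival_def)

text \<open>Derivatives are two-sided even at \<open>0\<close> and \<open>1\<close>, so that
  derivative tests on \<open>{0..1}\<close> apply without one-sided variants.\<close>

lemma survival_antiderivative:
  obtains K where "\<And>x. x \<in> {0..1} \<Longrightarrow> (K has_real_derivative f x) (at x)"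
    and "\<And>x. x \<in> {0..1} \<Longrightarrow> survival f x = K 1 - K x"
proof -
  \<comment> \<open>Clamping extends \<open>f\<close> continuously beyond \<open>{0..1}\<close>; an
    antiderivative on \<open>{-1..2}\<close> then has \<open>{0..1}\<close> in the interior of its
    domain.\<close>
  define g where "g x = f (max 0 (min 1 x))" for x
  have "continuous_on UNIV g"
    unfolding g_def by (rule continuous_on_compose2[OF continuous]) (auto intro!: continuous_on_max continuous_on_min continuous_on_const continuous_on_id)
  then have "continuous_on {-1..2} g"
    by (rule continuous_on_subset) simp
  then obtain K where K: "\<And>x. x \<in> {-1..2} \<Longrightarrow> (K has_vector_derivative g x) (at x within {-1..2})"
    using antiderivative_continuous[of "-1" 2 g] by blast
  have d: "(K has_real_derivative f x) (at x)" if "x \<in> {0..1}" for x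
  proof -
    have "at x within {-1..2} = at x"
      using that by (intro at_within_interior) auto
    moreover have "g x = f x" using that by (simp add: g_def)
    ultimately show ?thesis
      using K[of x] that by (simp add: has_real_derivative_iff_has_vector_derivative)
  qed
  have "survival f x = K 1 - K x" if "x \<in> {0..1}" for x
    unfolding survival_def set_lebesgue_integral_def
  proof (rule integral_FTC_atLeastAtMost)
    show "continuous_on {x..1} f" using that by (auto intro: continuous_on_subset[OF continuous])
    show "(K has_vector_derivative f y) (at y within {x..1})" if "x \<le> y" "y \<le> 1" for y
      using d[of y] that \<open>x \<in> {0..1}\<close>
      by (auto simp: has_real_derivative_iff_has_vector_derivative
          intro: has_vector_derivative_at_within)
  qed (use that in auto)
  with d show thesis using that by blast
qed

lemma survival_1: "survival f 1 = 0"
  by (rule survival_antiderivative) simp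

lemma survival_antimono:
  assumes "0 \<le> x" "x \<le> y" "y \<le> 1"
  shows "survival f y \<le> survival f x"
proof (rule survival_antiderivative)
  fix K assume K: "\<And>x. x \<in> {0..1} \<Longrightarrow> (K has_real_derivative f x) (at x)"
    and S: "\<And>x. x \<in> {0..1} \<Longrightarrow> survival f x = K 1 - K x"
  have "K x \<le> K y"
  proof (rule DERIV_nonneg_imp_nondecreasing[where f = K])
    show "\<exists>d. (K has_real_derivative d) (at z) \<and> 0 \<le> d" if "x \<le> z" "z \<le> y" for z
      using K[of z] nonneg[of z] that assms by auto
  qed (use assms in simp)
  then show ?thesis using assms S by simp
qed

lemma survival_nonneg: "x \<in> {0..1} \<Longrightarrow> 0 \<le> survival f x"
  using survival_antimono[of x 1] survival_1 by auto

lemma survival_le_1: "x \<in> {0..1} \<Longrightarrow> survival f x \<le> 1"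
  using survival_antimono[of 0 x] survival_0 by auto

text \<open>This is the domain used in \<open>welfare_concave\<close>, and the part of
  \<open>{0..1}\<close> where \<open>ln (survival f c)\<close> is a genuine logarithm.\<close>

definition positive_survival :: "real set" where
  "positive_survival = {c \<in> {0..1}. 0 < survival f c}"

lemma positive_survival_downward:
  assumes "y \<in> positive_survival" "0 \<le> x" "x \<le> y"
  shows "x \<in> positive_survival"
  using assms survival_antimono[of x y] by (auto simp: positive_survival_def)

lemma convex_positive_survival: "convex positive_survival"
proof -
  have "is_interval positive_survival"
    unfolding is_interval_1
    using positive_survival_downward by (metis (no_types, lifting) atLeastAtMost_iff mem_Collect_eq order_trans positive_survival_def)
  then show ?thesis by (simp add: is_interval_convex_1)
qed

text \<open>The points \<open>y\<close> and \<open>x + s\<close> lie between \<open>x\<close> and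
  \<open>y + s\<close> and have the same sum, so they are convex combinations of these with
  interchanged weights. Adding the two log-concavity inequalities gives the claim.\<close>

lemma log_concave_exchange:
  assumes lc: "log_concave f" and "0 \<le> x" "x < y" "0 \<le> s" "y + s \<le> 1"
  shows "f x * f (y + s) \<le> f y * f (x + s)"
proof (cases "f x = 0 \<or> f (y + s) = 0 \<or> s = 0")
  case True
  then show ?thesis using assms nonneg[of y] nonneg[of "x + s"] by auto
next
  case False
  then have pos: "0 < f x" "0 < f (y + s)" and "0 < s"
    using assms nonneg[of x] nonneg[of "y + s"] by auto
  \<comment> \<open>The lower bound on \<open>log_ext (f z)\<close> is finite, which excludes the
    value \<open>-\<infinity>\<close> and thus forces \<open>0 < f z\<close>.\<close>
  have *: "0 < f z \<and> (1 - t) * ln (f x) + t * ln (f (y + s)) \<le> ln (f z)"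
    if "z = (1 - t) * x + t * (y + s)" "t \<in> {0<..<1}" for t z
  proof -
    have "ereal (1 - t) * log_ext (f x) + ereal t * log_ext (f (y + s)) \<le> log_ext (f z)"
      using lc that assms unfolding log_concave_def by auto
    then show ?thesis using pos by (auto simp: log_ext_def split: if_splits)
  qed
  \<comment> \<open>The weight of \<open>y + s\<close> in the representation of
    \<open>x + s\<close>; the point \<open>y\<close> gets the weight \<open>1 - t\<close>.\<close>
  define t where "t = s / (y + s - x)"
  have t: "t \<in> {0<..<1}" "1 - t \<in> {0<..<1}"
    using \<open>0 < s\<close> \<open>x < y\<close> by (auto simp: t_def field_simps)
  have "t * (y + s - x) = s"
    using \<open>0 < s\<close> \<open>x < y\<close> by (simp add: t_def)
  then have "x + s = (1 - t) * x + t * (y + s)" "y = (1 - (1 - t)) * x + (1 - t) * (y + s)"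
    by (simp_all add: algebra_simps)
  from *[OF this(1) t(1)] *[OF this(2) t(2)]
  have "0 < f (x + s)" "0 < f y" "ln (f x) + ln (f (y + s)) \<le> ln (f y) + ln (f (x + s))"
    by (auto simp: algebra_simps)
  then have "ln (f x * f (y + s)) \<le> ln (f y * f (x + s))"
    using pos by (simp add: ln_mult)
  then show ?thesis using pos \<open>0 < f (x + s)\<close> \<open>0 < f y\<close> by simp
qed

text \<open>Integrate the exchange inequality over \<open>s\<close> from \<open>0\<close> to
  \<open>1 - y\<close>: the left side gives \<open>f x * survival f y\<close>, the right side
  \<open>f y\<close> times the mass of the interval from \<open>x\<close> to
  \<open>x + (1 - y)\<close>, which is at most \<open>survival f x\<close>.\<close>

lemma log_concave_hazard_rate:
  assumes lc: "log_concave f" and "0 \<le> x" "x \<le> y" "y \<le> 1"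
  shows "f x * survival f y \<le> f y * survival f x"
proof (cases "x = y")
  case False
  then have "x < y" using assms by simp
  obtain K where K: "\<And>x. x \<in> {0..1} \<Longrightarrow> (K has_real_derivative f x) (at x)"
    and S: "\<And>x. x \<in> {0..1} \<Longrightarrow> survival f x = K 1 - K x"
    using survival_antiderivative by blast
  \<comment> \<open>The integral up to \<open>s\<close> of right side minus left side of the
    exchange inequality.\<close>
  define D where "D s = f y * (K (x + s) - K x) - f x * (K (y + s) - K y)" for s
  have "D 0 \<le> D (1 - y)"
  proof (rule DERIV_nonneg_imp_nondecreasing[where f = D])
    fix s assume s: "0 \<le> s" "s \<le> 1 - y"
    have "((\<lambda>s. K (z + s)) has_real_derivative f (z + s)) (at s)" if "0 \<le> z" "z \<le> y" for z
      using DERIV_shift[of K "f (z + s)" s z] K[of "z + s"] s that assms by (simp add: add.commute)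
    from this[of x] this[of y] have "(D has_real_derivative f y * f (x + s) - f x * f (y + s)) (at s)"
      unfolding D_def using assms by (auto intro!: derivative_eq_intros)
    then show "\<exists>d. (D has_real_derivative d) (at s) \<and> 0 \<le> d"
      using log_concave_exchange[OF lc \<open>0 \<le> x\<close> \<open>x < y\<close>, of s] s by auto
  qed (use assms in simp)
  moreover have "K (x + (1 - y)) \<le> K 1"
    using assms S[of "x + (1 - y)"] survival_nonneg[of "x + (1 - y)"] by auto
  then have "f y * (K (x + (1 - y)) - K x) \<le> f y * (K 1 - K x)"
    using nonneg[of y] assms by (intro mult_left_mono) auto
  ultimately show ?thesis using assms by (simp add: D_def S)
qed simp

text \<open>The derivative of \<open>- ln (survival f c)\<close> is the hazard rate, which
  \<open>log_concave_hazard_rate\<close> shows to be nondecreasing.\<close>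

lemma concave_ln_survival:
  assumes lc: "log_concave f"
  shows "concave_on positive_survival (\<lambda>c. ln (survival f c))"
proof (rule survival_antiderivative)
  fix K assume K: "\<And>x. x \<in> {0..1} \<Longrightarrow> (K has_real_derivative f x) (at x)"
    and S: "\<And>x. x \<in> {0..1} \<Longrightarrow> survival f x = K 1 - K x"
  have "convex_on positive_survival (\<lambda>c. - ln (K 1 - K c))"
  proof (rule convex_on_realI)
    show "connected positive_survival" by (rule convex_connected[OF convex_positive_survival])
    show "((\<lambda>c. - ln (K 1 - K c)) has_real_derivative f c / survival f c) (at c)"
      if "c \<in> positive_survival" for c
      using that K[of c] S[of c] by (auto simp: positive_survival_def intro!: derivative_eq_intros)
    show "f x / survival f x \<le> f y / survival f y"
      if "x \<in> positive_survival" "y \<in> positive_survival" "x \<le> y" for x y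
      using that log_concave_hazard_rate[OF lc, of x y]
      by (auto simp: positive_survival_def field_simps)
  qed
  then show ?thesis
    unfolding concave_on_def
    by (rule convex_on_congI) (auto simp: positive_survival_def S)
qed

lemma convex_survival:
  assumes "antimono_on {0..1} f"
  shows "convex_on {0..1} (survival f)"
proof (rule survival_antiderivative)
  fix K assume K: "\<And>x. x \<in> {0..1} \<Longrightarrow> (K has_real_derivative f x) (at x)"
    and S: "\<And>x. x \<in> {0..1} \<Longrightarrow> survival f x = K 1 - K x"
  have "convex_on {0..1} (\<lambda>c. K 1 - K c)"
    using assms by (intro convex_on_realI[where f' = "\<lambda>x. - f x"])
      (auto intro!: derivative_eq_intros K simp: monotone_on_def)
  then show ?thesis
    by (rule convex_on_congI) (simp add: S)
qed

text \<open>Jensen's inequality with equal weights: the shares sum to \<open>1\<close>, so their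
  mean is \<open>1 / card S\<close>.\<close>

lemma sum_survival_ge:
  assumes "antimono_on {0..1} f" and S: "finite S" "S \<noteq> {}"
    and c: "\<And>i. i \<in> S \<Longrightarrow> c i \<in> {0..1}" and "(\<Sum>i\<in>S. c i) = 1"
  shows "real (card S) * survival f (1 / card S) \<le> (\<Sum>i\<in>S. survival f (c i))"
proof -
  have "real (card S) > 0" using S by (simp add: card_gt_0_iff)
  then show ?thesis
    using convex_on_sum[OF S convex_survival[OF assms(1)], of "\<lambda>_. 1 / card S" c] c assms(5)
    by (simp add: sum_divide_distrib[symmetric] field_simps)
qed

text \<open>Jensen's inequality for \<open>ln (survival f c)\<close>, with the logarithm then
  cancelled. The first claim makes the logarithm at the mean share meaningful.\<close>

lemma prod_survival_le:
  assumes lc: "log_concave f" and S: "finite S" "S \<noteq> {}"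
    and c: "\<And>i. i \<in> S \<Longrightarrow> c i \<in> positive_survival" and "(\<Sum>i\<in>S. c i) = 1"
  shows "1 / card S \<in> positive_survival"
    and "(\<Prod>i\<in>S. survival f (c i)) \<le> survival f (1 / card S) ^ card S"
proof -
  have n: "real (card S) > 0" using S by (simp add: card_gt_0_iff)
  have mean: "(\<Sum>i\<in>S. (1 / card S) *\<^sub>R c i) = 1 / card S"
    using assms(5) by (simp add: sum_divide_distrib[symmetric])
  have "(\<Sum>i\<in>S. (1 / card S) *\<^sub>R c i) \<in> positive_survival"
    using S c n by (intro convex_sum[OF _ convex_positive_survival]) auto
  then show *: "1 / card S \<in> positive_survival" using mean by simp
  have "(\<Sum>i\<in>S. 1 / card S * ln (survival f (c i))) \<le> ln (survival f (1 / card S))"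
    using concave_on_sum[OF S concave_ln_survival[OF lc], of "\<lambda>_. 1 / card S" c] c mean n
    by simp
  then have "(\<Sum>i\<in>S. ln (survival f (c i))) \<le> card S * ln (survival f (1 / card S))"
    using n by (simp add: sum_divide_distrib[symmetric] field_simps)
  also have "\<dots> = ln (survival f (1 / card S) ^ card S)"
    using * by (simp add: ln_realpow positive_survival_def)
  also have "(\<Sum>i\<in>S. ln (survival f (c i))) = ln (\<Prod>i\<in>S. survival f (c i))"
    using S(1) c by (intro ln_prod[symmetric]) (force simp: positive_survival_def)+
  finally show "(\<Prod>i\<in>S. survival f (c i)) \<le> survival f (1 / card S) ^ card S"
    using * c by (subst (asm) ln_le_cancel_iff) (auto simp: positive_survival_def intro!: prod_pos)
qed

end

section \<open>Reward of the chosen coalition\<close>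

lemma prod_indicator_eq_if:
  assumes "finite S"
  shows "(\<Prod>i\<in>S. indicator (A i) (v i)) = (if \<forall>i\<in>S. v i \<in> A i then 1 else 0 :: real)"
  using assms by (auto simp: indicator_def)

text \<open>For \<open>S\<close> the grand coalition or all but one agent, the indicators single out
  the profiles at which \<open>S\<close> is chosen: members accept their shares in \<open>S\<close>,
  an outsider rejects the share in the grand coalition. In product form the expectation factorizes
  by independence.\<close>

definition coalition_reward ::
    "nat \<Rightarrow> (nat set \<Rightarrow> nat \<Rightarrow> real) \<Rightarrow> (real \<Rightarrow> real \<Rightarrow> real) \<Rightarrow> profile \<Rightarrow> nat set \<Rightarrow> real" where
  "coalition_reward n c r v S =
     (\<Prod>i\<in>S. indicator {c S i..} (v i)) *
     (\<Prod>i\<in>{1..n} - S. indicator {..<c {1..n} i} (v i)) * (\<Sum>i\<in>S. r (v i) (c S i))"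

lemma valid_cost_shares_unit_interval:
  assumes "valid_cost_shares n c" "coalition n S" "i \<in> S"
  shows "c S i \<in> {0..1}"
proof -
  have "finite S" using assms(2) by (auto simp: coalition_def intro: finite_subset)
  then have "c S i \<le> sum (c S) S"
    using assms by (intro member_le_sum) (auto simp: valid_cost_shares_def)
  then show ?thesis using assms by (auto simp: valid_cost_shares_def)
qed

lemma coalition_reward_eq_if:
  assumes "coalition n S"
  shows "coalition_reward n c r v S =
     (if approved n c v S \<and> (\<forall>i\<in>{1..n} - S. v i < c {1..n} i)
      then \<Sum>i\<in>S. r (v i) (c S i) else 0)"
proof -
  have "finite S" using assms by (auto simp: coalition_def intro: finite_subset)
  then show ?thesis
    unfolding coalition_reward_def approved_def
    by (subst (1 2) prod_indicator_eq_if) (auto simp: assms)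
qed

lemma coalition_remove1:
  assumes "n \<in> {2, 3}"
  shows "coalition n ({1..n} - {k})"
proof -
  have "{1..n} = {1, 2} \<or> {1..n} = {1, 2, 3}" using assms by auto
  then show ?thesis by (auto simp: coalition_def)
qed

text \<open>Count the members and the outsiders. Here the bound \<open>n \<le> 3\<close> enters:
  among four agents a pair fits none of the cases. For \<open>n = 2\<close> the last two cases
  overlap.\<close>

lemma coalition_subset_cases:
  assumes "n \<in> {2, 3}" and S: "coalition n S"
  obtains "S = {1..n}" | k where "k \<in> {1..n}" "S = {1..n} - {k}" | i where "i \<in> {1..n}" "S = {i}"
proof -
  have fin: "finite S" and sub: "S \<subseteq> {1..n}" and ne: "S \<noteq> {}"
    using S by (auto simp: coalition_def intro: finite_subset)
  have card: "card ({1..n} - S) = n - card S" using sub fin by (simp add: card_Diff_subset)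
  consider "card S = 1" | "card ({1..n} - S) = 1" | "card ({1..n} - S) = 0"
    using assms(1) card ne fin by (cases "card S") force+
  then show thesis
  proof cases
    case 1
    then show thesis using that(3) sub by (auto simp: card_1_singleton_iff)
  next
    case 2
    then obtain k where "{1..n} - S = {k}" by (auto simp: card_1_singleton_iff)
    then show thesis using that(2)[of k] sub by blast
  next
    case 3
    then show thesis using that(1) sub by auto
  qed
qed

text \<open>The coalitions left out are the singletons, which must pay the full cost \<open>1\<close>.\<close>

lemma reward_eq_sum_coalition_reward:
  assumes n: "n \<in> {2, 3}" and c: "valid_cost_shares n c" and v: "\<And>i. i \<in> {1..n} \<Longrightarrow> v i < 1"
  defines "N \<equiv> {1..n}" and "m \<equiv> unanimous_mechanism n c v"
  shows "(\<Sum>i\<in>consumers m. r (v i) (payment m i)) =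
     coalition_reward n c r v N + (\<Sum>k\<in>N. coalition_reward n c r v (N - {k}))"
proof -
  have coN: "coalition n N" using n by (auto simp: N_def coalition_def)
  have cok: "coalition n (N - {k})" for k
    unfolding N_def by (rule coalition_remove1) (use n in auto)
  define L where "L = largest_approved n c v"
  have m: "(\<Sum>i\<in>consumers m. r (v i) (payment m i)) =
      (if \<exists>S. approved n c v S then \<Sum>i\<in>L. r (v i) (c L i) else 0)"
    by (simp add: m_def unanimous_mechanism_def L_def Let_def)
  have rN: "coalition_reward n c r v N =
      (if approved n c v N then \<Sum>i\<in>N. r (v i) (c N i) else 0)"
    using coalition_reward_eq_if[OF coN] by (simp add: N_def)
  have rk: "coalition_reward n c r v (N - {k}) =
      (if approved n c v (N - {k}) \<and> v k < c N k then \<Sum>i\<in>N - {k}. r (v i) (c (N - {k}) i) else 0)"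
    if "k \<in> N" for k
  proof -
    have "{1..n} - (N - {k}) = {k}" using that by (auto simp: N_def)
    then show ?thesis using coalition_reward_eq_if[OF cok] by (simp add: N_def)
  qed
  show ?thesis
  proof (cases "\<exists>S. approved n c v S")
    case False
    then show ?thesis using rN rk by (simp add: m)
  next
    case True
    note LA = largest_approved(1)[OF c True, folded L_def] and LG = largest_approved(2)[OF c True, folded L_def]
    have "coalition n L" using LA by (simp add: approved_def)
    from n this show ?thesis
    proof (cases rule: coalition_subset_cases)
      case 1
      then have "L = N" by (simp add: N_def)
      then have "coalition_reward n c r v (N - {k}) = 0" if "k \<in> N" for k
        using LA that rk[OF that] by (auto simp: approved_def)
      then show ?thesis using True LA rN \<open>L = N\<close> by (simp add: m)
    next
      case (2 k)
      then have k: "k \<in> N" "L = N - {k}" by (simp_all add: N_def)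
      have "\<not> approved n c v N" using LG[of N] k by auto
      \<comment> \<open>If \<open>k\<close> accepted the share in \<open>N\<close>, so would
        everyone else: the others accept their shares in \<open>N - {k}\<close>, which are at least
        those in \<open>N\<close>. Then \<open>N\<close> would be approved, although
        \<open>L\<close> is the largest approved coalition.\<close>
      moreover have "v k < c N k"
      proof (rule ccontr)
        assume "\<not> v k < c N k"
        moreover have "c N i \<le> v i" if "i \<in> N - {k}" for i
        proof -
          have "c N i \<le> c (N - {k}) i"
            using c coN cok[of k] k that unfolding valid_cost_shares_def by blast
          also have "\<dots> \<le> v i" using LA that k by (auto simp: approved_def)
          finally show ?thesis .
        qed
        ultimately have "\<forall>i\<in>N. c N i \<le> v i" by force
        then have "approved n c v N" using coN by (simp add: approved_def)
        with \<open>\<not> approved n c v N\<close> show False ..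
      qed
      \<comment> \<open>\<open>N - {k'}\<close> contains \<open>k\<close>, hence is not a subset of
        \<open>L\<close>. So a single term of the sum survives.\<close>
      moreover have "\<not> approved n c v (N - {k'})" if "k' \<in> N - {k}" for k'
        using LG[of "N - {k'}"] k that by auto
      ultimately have "coalition_reward n c r v N = 0"
        and "coalition_reward n c r v (N - {k}) = (\<Sum>i\<in>L. r (v i) (c L i))"
        and "\<And>k'. k' \<in> N - {k} \<Longrightarrow> coalition_reward n c r v (N - {k'}) = 0"
        using k LA rN rk by auto
      then show ?thesis
        using k True sum.remove[of N k "\<lambda>k. coalition_reward n c r v (N - {k})"]
        by (simp add: m N_def)
    next
      case (3 i)
      then have "c L i = 1" using c \<open>coalition n L\<close> by (auto simp: valid_cost_shares_def)
      then show ?thesis using LA 3 v[of i] by (auto simp: approved_def)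
    qed
  qed
qed

text \<open>\<open>r x c\<close> is the reward for a consumer of valuation \<open>x\<close> who pays
  \<open>c\<close>. The constant \<open>1\<close> counts consumers and \<open>x - c\<close> measures
  welfare, so one argument serves both objectives.\<close>

definition expected_reward :: "nat \<Rightarrow> (real \<Rightarrow> real) \<Rightarrow> (real \<Rightarrow> real \<Rightarrow> real) \<Rightarrow> mechanism \<Rightarrow> real" where
  "expected_reward n f r m =
     (\<integral>v. (\<Sum>i\<in>consumers (m v). r (v i) (payment (m v) i)) \<partial>profile_measure n f)"

lemma expected_consumers_eq_reward: "expected_consumers n f = expected_reward n f (\<lambda>_ _. 1)"
  by (simp add: fun_eq_iff expected_consumers_def expected_reward_def)

lemma expected_welfare_eq_reward:
  assumes "largest_unanimous n m"
  shows "expected_welfare n f m = expected_reward n f (\<lambda>x c. x - c) m"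
proof -
  obtain c where c: "valid_cost_shares n c" and m: "m = unanimous_mechanism n c"
    using assms by (auto simp: largest_unanimous_def)
  have "consumers (m v) \<subseteq> {1..n}" for v
    using largest_approved(1)[OF c]
    by (auto simp: m unanimous_mechanism_def Let_def approved_def coalition_def)
  then have "(\<Sum>i\<in>{1..n}. utility v (m v) i) = (\<Sum>i\<in>consumers (m v). v i - payment (m v) i)" for v
    unfolding utility_def by (simp add: sum.If_cases Int_absorb1)
  then show ?thesis by (simp add: expected_welfare_def expected_reward_def)
qed

lemma valid_serial_cost_shares: "valid_cost_shares n (\<lambda>S i. 1 / real (card S))"
proof -
  have "finite S \<and> S \<noteq> {}" if "coalition n S" for S
    using that by (auto simp: coalition_def intro: finite_subset)
  then show ?thesis
    by (auto simp: valid_cost_shares_def card_gt_0_iff intro!: divide_left_mono card_mono)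
qed

lemma largest_unanimous_serial: "largest_unanimous n (serial_cost_sharing n)"
  unfolding largest_unanimous_def serial_cost_sharing_def using valid_serial_cost_shares by blast

section \<open>Integrals against the valuation distribution\<close>

context unit_interval_density
begin

lemma measurable_density [measurable]: "(\<lambda>x. indicator {0..1} x * f x) \<in> borel_measurable borel"
  using borel_measurable_continuous_on_indicator[OF _ continuous] by simp

lemma sets_valuation_measure [measurable_cong]: "sets (valuation_measure f) = sets borel"
  by (simp add: valuation_measure_def)

lemma integral_valuation_measure:
  assumes "g \<in> borel_measurable borel"
  shows "(\<integral>x. g x \<partial>valuation_measure f) = (LINT x:{0..1}|lborel. g x * f x)"
  unfolding valuation_measure_def set_lebesgue_integral_def
proof (subst integral_density)
  show "AE x in lborel. 0 \<le> indicator {0..1} x * f x"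
    by (auto simp: indicator_def nonneg)
qed (use assms measurable_density in \<open>simp_all add: ac_simps\<close>)

lemma set_integrable_density: "set_integrable lborel {0..1} f"
  using continuous by (rule borel_integrable_atLeastAtMost')

lemma prob_space_valuation_measure: "prob_space (valuation_measure f)"
proof
  have "emeasure (valuation_measure f) (space (valuation_measure f)) =
      (\<integral>\<^sup>+x. ennreal (indicator {0..1} x * f x) \<partial>lborel)"
    by (simp add: valuation_measure_def emeasure_density)
  also have "\<dots> = ennreal (LINT x:{0..1}|lborel. f x)"
    unfolding set_lebesgue_integral_def
    using set_integrable_density
    by (subst nn_integral_eq_integral) (auto simp: set_integrable_def indicator_def nonneg)
  finally show "emeasure (valuation_measure f) (space (valuation_measure f)) = 1"
    using unit_density by (simp add: unit_density_def)
qed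

sublocale valuation: prob_space "valuation_measure f"
  by (rule prob_space_valuation_measure)

sublocale profile: product_prob_space "\<lambda>_ :: nat. valuation_measure f"
  by unfold_locales

text \<open>A single point is a null set. Excluding the valuation \<open>1\<close> later rules out
  an agent who pays the full cost alone.\<close>

lemma AE_valuation_measure: "AE x in valuation_measure f. x \<in> {0..<1}"
proof -
  have "AE x in lborel. x \<noteq> (1 :: real)" by (rule AE_lborel_singleton)
  then show ?thesis
    unfolding valuation_measure_def
    by (subst AE_density) (use measurable_density in simp, auto simp: indicator_def split: if_splits)
qed

lemma integral_upper_tail:
  assumes "c \<in> {0..1}" and "g \<in> borel_measurable borel"
  shows "(\<integral>x. indicator {c..} x * g x \<partial>valuation_measure f) = (LINT x:{c..1}|lborel. g x * f x)"
  using assms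
  by (subst integral_valuation_measure)
    (auto simp: set_lebesgue_integral_def indicator_def intro!: Bochner_Integration.integral_cong)

lemma integral_indicator_upper:
  "c \<in> {0..1} \<Longrightarrow> (\<integral>x. indicator {c..} x \<partial>valuation_measure f) = survival f c"
  using integral_upper_tail[of c "\<lambda>_. 1"] by (simp add: survival_def)

lemma integral_indicator_lower:
  assumes "c \<in> {0..1}"
  shows "(\<integral>x. indicator {..<c} x \<partial>valuation_measure f) = 1 - survival f c"
proof -
  have "(\<integral>x. indicator {..<c} x \<partial>valuation_measure f) =
      (\<integral>x. (1 - indicator {c..} x :: real) \<partial>valuation_measure f)"
    by (intro Bochner_Integration.integral_cong) (auto simp: indicator_def)
  also have "\<dots> = 1 - (\<integral>x. indicator {c..} x \<partial>valuation_measure f)"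
    by (subst Bochner_Integration.integral_diff)
      (auto simp: valuation.prob_space intro!: valuation.integrable_const_bound[where B = 1])
  finally show ?thesis using integral_indicator_upper[OF assms] by simp
qed

lemma AE_profile_measure: "AE v in profile_measure n f. \<forall>i\<in>{1..n}. v i < 1"
proof -
  have "AE v in profile_measure n f. v i < 1" if "i \<in> {1..n}" for i
    unfolding profile_measure_def using AE_valuation_measure that
    by (intro AE_PiM_component[where P = "\<lambda>x. x < 1"] prob_space_valuation_measure) auto
  then show ?thesis by (intro AE_finite_allI) auto
qed

end

text \<open>\<open>u c\<close> is the mean of \<open>r x c\<close> over the valuations \<open>x \<ge> c\<close>. The equation defining it is multiplied
  out, so that it is unconstrained where \<open>survival f c = 0\<close>.\<close>

locale reward_density = unit_interval_density +
  fixes r :: "real \<Rightarrow> real \<Rightarrow> real" and u :: "real \<Rightarrow> real"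
  assumes r_measurable: "\<And>c. (\<lambda>x. r x c) \<in> borel_measurable borel"
    and r_bounded: "\<And>x c. x \<in> {0..1} \<Longrightarrow> c \<in> {0..1} \<Longrightarrow> \<bar>r x c\<bar> \<le> 1"
    and r_mean: "\<And>c. c \<in> {0..1} \<Longrightarrow> (LINT x:{c..1}|lborel. r x c * f x) = u c * survival f c"
    and u_nonneg: "\<And>c. c \<in> {0..1} \<Longrightarrow> 0 \<le> u c"
    and u_concave: "concave_on positive_survival u"
begin

section \<open>The expected reward as a function of the cost shares\<close>

lemma integral_reward:
  "c \<in> {0..1} \<Longrightarrow> (\<integral>x. indicator {c..} x * r x c \<partial>valuation_measure f) = u c * survival f c"
  using integral_upper_tail[OF _ r_measurable] r_mean by simp

text \<open>The reward is a sum over members \<open>j\<close> of products of functions of one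
  valuation each, and independence turns the expectation of each product into a product of
  expectations.\<close>

lemma coalition_reward_integral:
  assumes c: "valid_cost_shares n c" and S: "coalition n S"
  shows "integrable (profile_measure n f) (\<lambda>v. coalition_reward n c r v S)"
    and "(\<integral>v. coalition_reward n c r v S \<partial>profile_measure n f) =
      (\<Prod>i\<in>S. survival f (c S i)) * (\<Prod>i\<in>{1..n} - S. 1 - survival f (c {1..n} i)) *
      (\<Sum>i\<in>S. u (c S i))"
proof -
  \<comment> \<open>The factor of agent \<open>i\<close> in the summand of member \<open>j\<close>:
    an acceptance or rejection indicator, with the reward attached only at \<open>i = j\<close>.
    \<open>H j i\<close> is its mean.\<close>
  define h where "h j i x = (if i \<in> S then indicator {c S i..} x * (if i = j then r x (c S i) else 1)
      else indicator {..<c {1..n} i} x)" for j i x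
  define H where "H j i = (if i \<in> S then survival f (c S i) * (if i = j then u (c S i) else 1)
      else 1 - survival f (c {1..n} i))" for j i
  have sub: "S \<subseteq> {1..n}" and fin: "finite S"
    using S by (auto simp: coalition_def intro: finite_subset)
  have cS: "c S i \<in> {0..1}" if "i \<in> S" for i
    using valid_cost_shares_unit_interval[OF c S that] .
  have cN: "c {1..n} i \<in> {0..1}" if "i \<in> {1..n}" for i
    using that by (intro valid_cost_shares_unit_interval[OF c]) (auto simp: coalition_def)
  \<comment> \<open>The same regrouping is applied twice, to the integrands \<open>h\<close> and to
    their means \<open>H\<close>.\<close>
  have prod_split: "(\<Prod>i\<in>{1..n}. if i \<in> S then a i * (if i = j then b i else 1) else d i) =
      (\<Prod>i\<in>S. a i) * (\<Prod>i\<in>{1..n} - S. d i) * b j" if "j \<in> S"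
    for a b d :: "nat \<Rightarrow> real" and j
  proof -
    have "(\<Prod>i\<in>{1..n}. if i \<in> S then a i * (if i = j then b i else 1) else d i) =
        (\<Prod>i\<in>{1..n} - S. d i) * (\<Prod>i\<in>S. a i * (if i = j then b i else 1))"
      using sub by (subst prod.subset_diff[of S]) (auto intro!: arg_cong2[where f = "(*)"] prod.cong)
    also have "(\<Prod>i\<in>S. a i * (if i = j then b i else 1)) = (\<Prod>i\<in>S. a i) * b j"
      using fin that by (simp add: prod.distrib prod.delta)
    finally show ?thesis by simp
  qed
  have reward: "coalition_reward n c r v S = (\<Sum>j\<in>S. \<Prod>i\<in>{1..n}. h j i (v i))" for v
    unfolding coalition_reward_def sum_distrib_left h_def
    by (intro sum.cong refl) (simp only: prod_split)
  have meas: "h j i \<in> borel_measurable borel" for j i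
    using r_measurable unfolding h_def by (cases "i \<in> S"; cases "i = j") simp_all
  have int: "integrable (valuation_measure f) (h j i)" for j i
  proof (rule valuation.integrable_const_bound[where B = 1])
    show "AE x in valuation_measure f. norm (h j i x) \<le> 1"
      using AE_valuation_measure
    proof eventually_elim
      case (elim x)
      then show ?case using r_bounded[of x "c S i"] cS[of i] by (auto simp: h_def indicator_def)
    qed
  qed (use meas in simp)
  have integral: "(\<integral>x. h j i x \<partial>valuation_measure f) = H j i" if "i \<in> {1..n}" for j i
    using integral_reward[OF cS, of i] integral_indicator_upper[OF cS, of i]
      integral_indicator_lower[OF cN, of i] that
    by (auto simp: h_def H_def)
  show "integrable (profile_measure n f) (\<lambda>v. coalition_reward n c r v S)"
    unfolding reward profile_measure_def
    by (intro Bochner_Integration.integrable_sum profile.product_integrable_prod int) simp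
  have "(\<integral>v. coalition_reward n c r v S \<partial>profile_measure n f) =
      (\<Sum>j\<in>S. \<integral>v. (\<Prod>i\<in>{1..n}. h j i (v i)) \<partial>profile_measure n f)"
    unfolding reward profile_measure_def
    by (intro Bochner_Integration.integral_sum profile.product_integrable_prod int) simp
  also have "\<dots> = (\<Sum>j\<in>S. \<Prod>i\<in>{1..n}. \<integral>x. h j i x \<partial>valuation_measure f)"
    unfolding profile_measure_def
    by (intro sum.cong refl profile.product_integral_prod int) simp
  also have "\<dots> = (\<Sum>j\<in>S. \<Prod>i\<in>{1..n}. H j i)"
    by (intro sum.cong prod.cong refl integral)
  also have "\<dots> = (\<Prod>i\<in>S. survival f (c S i)) * (\<Prod>i\<in>{1..n} - S. 1 - survival f (c {1..n} i)) *
      (\<Sum>i\<in>S. u (c S i))"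
    unfolding sum_distrib_left H_def by (intro sum.cong refl) (simp only: prod_split)
  finally show "(\<integral>v. coalition_reward n c r v S \<partial>profile_measure n f) = \<dots>" .
qed

text \<open>Needed to replace the integrand almost everywhere. Summing over all candidates for the
  chosen coalition removes \<open>GREATEST\<close> and leaves finitely many threshold conditions on
  the valuations.\<close>

lemma mechanism_reward_measurable:
  assumes c: "valid_cost_shares n c"
  shows "(\<lambda>v. \<Sum>i\<in>consumers (unanimous_mechanism n c v).
      r (v i) (payment (unanimous_mechanism n c v) i)) \<in> borel_measurable (profile_measure n f)"
proof -
  let ?M = "profile_measure n f"
  define largest where "largest v S \<longleftrightarrow>
      approved n c v S \<and> (\<forall>T\<in>Pow {1..n}. approved n c v T \<longrightarrow> T \<subseteq> S)" for v S
  have eq: "(\<Sum>i\<in>consumers (unanimous_mechanism n c v). r (v i) (payment (unanimous_mechanism n c v) i)) =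
      (\<Sum>S\<in>Pow {1..n}. if largest v S then \<Sum>i\<in>S. r (v i) (c S i) else 0)" for v
  proof (cases "\<exists>S. approved n c v S")
    case True
    note L = largest_approved[OF c True]
    have sub: "largest_approved n c v \<in> Pow {1..n}"
      using L(1) by (simp add: approved_def coalition_def)
    have "largest v S \<longleftrightarrow> largest_approved n c v = S" for S
      using L(1) L(2)[of S] L(2) sub unfolding largest_def by (metis subset_antisym)
    then show ?thesis
      using True sub by (simp add: unanimous_mechanism_def Let_def sum.delta')
  next
    case False
    then show ?thesis by (simp add: unanimous_mechanism_def largest_def)
  qed
  have component [measurable]: "(\<lambda>v. v i) \<in> borel_measurable ?M" if "i \<in> {1..n}" for i
    unfolding profile_measure_def using measurable_component_singleton[OF that, of "\<lambda>_. valuation_measure f"]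
    by (simp only: measurable_cong_sets[OF refl sets_valuation_measure])
  have approved [measurable]: "Measurable.pred ?M (\<lambda>v. approved n c v S)" if "S \<in> Pow {1..n}" for S
  proof -
    have [measurable]: "(\<lambda>v. v i) \<in> borel_measurable ?M" if "i \<in> S" for i
      using component that \<open>S \<in> Pow {1..n}\<close> by auto
    have "finite S" using that by (auto intro: finite_subset)
    then show ?thesis unfolding approved_def by measurable
  qed
  have largest: "Measurable.pred ?M (\<lambda>v. largest v S)" if "S \<in> Pow {1..n}" for S
    unfolding largest_def using approved that
    by (intro pred_intros_logic pred_intros_finite) auto
  have reward: "(\<lambda>v. \<Sum>i\<in>S. r (v i) (c S i)) \<in> borel_measurable ?M" if "S \<in> Pow {1..n}" for S
    using that by (intro borel_measurable_sum measurable_compose[OF component r_measurable]) auto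
  show ?thesis
    unfolding eq
    by (rule borel_measurable_sum, rule measurable_If)
      (use largest reward in \<open>simp_all add: pred_def\<close>)
qed

text \<open>The expected total reward of \<open>S\<close> on the event that all its members
  accept.\<close>

definition coalition_value :: "(nat set \<Rightarrow> nat \<Rightarrow> real) \<Rightarrow> nat set \<Rightarrow> real" where
  "coalition_value c S = (\<Prod>i\<in>S. survival f (c S i)) * (\<Sum>i\<in>S. u (c S i))"

text \<open>Integrate the decomposition \<open>reward_eq_sum_coalition_reward\<close>, valid almost
  surely, term by term; \<open>1 - survival f (c N k)\<close> is the probability that
  \<open>k\<close> rejects the share in \<open>N\<close>.\<close>

lemma expected_reward_unanimous:
  assumes n: "n \<in> {2, 3}" and c: "valid_cost_shares n c"
  defines "N \<equiv> {1..n}"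
  shows "expected_reward n f r (unanimous_mechanism n c) =
    coalition_value c N + (\<Sum>k\<in>N. (1 - survival f (c N k)) * coalition_value c (N - {k}))"
proof -
  have coN: "coalition n N" using n by (auto simp: N_def coalition_def)
  have cok: "coalition n (N - {k})" for k
    unfolding N_def by (rule coalition_remove1) (use n in auto)
  note int = coalition_reward_integral[OF c]
  have "expected_reward n f r (unanimous_mechanism n c) =
      (\<integral>v. coalition_reward n c r v N + (\<Sum>k\<in>N. coalition_reward n c r v (N - {k}))
        \<partial>profile_measure n f)"
    unfolding expected_reward_def
  proof (rule integral_cong_AE)
    show "AE v in profile_measure n f.
        (\<Sum>i\<in>consumers (unanimous_mechanism n c v). r (v i) (payment (unanimous_mechanism n c v) i)) =
        coalition_reward n c r v N + (\<Sum>k\<in>N. coalition_reward n c r v (N - {k}))"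
      using AE_profile_measure
      by eventually_elim (use reward_eq_sum_coalition_reward[OF n c] in \<open>simp add: N_def\<close>)
  qed (use mechanism_reward_measurable[OF c] int(1) coN cok in
      \<open>auto intro!: borel_measurable_add borel_measurable_sum\<close>)
  also have "\<dots> = (\<integral>v. coalition_reward n c r v N \<partial>profile_measure n f) +
      (\<Sum>k\<in>N. \<integral>v. coalition_reward n c r v (N - {k}) \<partial>profile_measure n f)"
    using int(1) coN cok by simp
  also have "(\<integral>v. coalition_reward n c r v N \<partial>profile_measure n f) = coalition_value c N"
    using int(2)[OF coN] by (simp add: coalition_value_def N_def)
  also have "(\<Sum>k\<in>N. \<integral>v. coalition_reward n c r v (N - {k}) \<partial>profile_measure n f) =
      (\<Sum>k\<in>N. (1 - survival f (c N k)) * coalition_value c (N - {k}))"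
  proof (rule sum.cong)
    fix k assume "k \<in> N"
    then have "{1..n} - (N - {k}) = {k}" by (auto simp: N_def)
    then show "(\<integral>v. coalition_reward n c r v (N - {k}) \<partial>profile_measure n f) =
        (1 - survival f (c N k)) * coalition_value c (N - {k})"
      using int(2)[OF cok[of k]] by (simp add: coalition_value_def N_def)
  qed simp
  finally show ?thesis .
qed

section \<open>Comparison with equal shares\<close>

definition serial_value :: "nat \<Rightarrow> real" where
  "serial_value s = survival f (1 / s) ^ s * (s * u (1 / s))"

lemma coalition_value_serial: "coalition_value (\<lambda>S i. 1 / real (card S)) S = serial_value (card S)"
  by (simp add: coalition_value_def serial_value_def)

lemma serial_value_nonneg: "0 \<le> serial_value s"
  using u_nonneg[of "1 / s"] survival_nonneg[of "1 / s"]
  by (cases s) (auto simp: serial_value_def)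

text \<open>Both factors of the value are nonnegative and, by Jensen's inequality, largest at equal
  shares. Jensen applies only within \<open>positive_survival\<close>; if some share lies outside,
  the product and hence the value is \<open>0\<close>.\<close>

lemma coalition_value_le_serial:
  assumes lc: "log_concave f" and c: "valid_cost_shares n c" and S: "coalition n S"
  shows "coalition_value c S \<le> serial_value (card S)"
proof (cases "\<forall>i\<in>S. c S i \<in> positive_survival")
  case True
  have fin: "finite S" "S \<noteq> {}" using S by (auto simp: coalition_def intro: finite_subset)
  then have n: "real (card S) > 0" by (simp add: card_gt_0_iff)
  have sum: "(\<Sum>i\<in>S. c S i) = 1" using c S by (simp add: valid_cost_shares_def)
  note P = prod_survival_le[OF lc fin, of "c S", OF _ sum]
  have "(\<Sum>i\<in>S. u (c S i)) \<le> card S * u (1 / card S)"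
    using concave_on_sum[OF fin u_concave, of "\<lambda>_. 1 / card S" "c S"] True n sum
    by (simp add: sum_divide_distrib[symmetric] field_simps)
  then show ?thesis
    unfolding coalition_value_def serial_value_def
    using True P by (intro mult_mono sum_nonneg u_nonneg zero_le_power)
      (auto simp: positive_survival_def)
next
  case False
  then obtain i where "i \<in> S" "survival f (c S i) = 0"
    using valid_cost_shares_unit_interval[OF c S] survival_nonneg
    by (force simp: positive_survival_def)
  moreover have "finite S" using S by (auto simp: coalition_def intro: finite_subset)
  ultimately have "coalition_value c S = 0" by (auto simp: coalition_value_def)
  then show ?thesis using serial_value_nonneg by simp
qed

text \<open>For \<open>n = 2\<close> the coalitions \<open>N - {k}\<close> are worth \<open>0\<close>, because \<open>survival f 1 = 0\<close>.\<close>

lemma serial_cost_sharing_optimal: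
  assumes n: "n = 2 \<or> n = 3 \<and> antimono_on {0..1} f" and lc: "log_concave f"
  shows "is_arg_max (expected_reward n f r) (largest_unanimous n) (serial_cost_sharing n)"
proof -
  have n': "n \<in> {2, 3}" using n by auto
  define N where "N = {1..n}"
  have N: "finite N" "N \<noteq> {}" "card N = n" using n by (auto simp: N_def)
  have coN: "coalition n N" using n by (auto simp: N_def coalition_def)
  have cok: "coalition n (N - {k})" for k
    unfolding N_def by (rule coalition_remove1) (use n in auto)
  have card_k: "card (N - {k}) = n - 1" if "k \<in> N" for k using that N by simp
  note reward_eq = expected_reward_unanimous[OF n', folded N_def]
  have serial: "expected_reward n f r (serial_cost_sharing n) =
      serial_value n + (n - n * survival f (1 / n)) * serial_value (n - 1)"
    using reward_eq[OF valid_serial_cost_shares] card_k N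
    by (simp add: serial_cost_sharing_def coalition_value_serial algebra_simps)
  have "expected_reward n f r (unanimous_mechanism n c) \<le> expected_reward n f r (serial_cost_sharing n)"
    if c: "valid_cost_shares n c" for c
  proof -
    have c01: "c N k \<in> {0..1}" if "k \<in> N" for k
      using valid_cost_shares_unit_interval[OF c coN that] .
    \<comment> \<open>First the values of the coalitions \<open>N - {k}\<close> are bounded at fixed
      rejection probabilities, then the total rejection probability.\<close>
    have "(\<Sum>k\<in>N. (1 - survival f (c N k)) * coalition_value c (N - {k}))
        \<le> (\<Sum>k\<in>N. (1 - survival f (c N k)) * serial_value (n - 1))"
    proof (intro sum_mono mult_left_mono)
      show "coalition_value c (N - {k}) \<le> serial_value (n - 1)" if "k \<in> N" for k
        using coalition_value_le_serial[OF lc c cok[of k]] card_k[OF that] by simp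
      show "0 \<le> 1 - survival f (c N k)" if "k \<in> N" for k
        using survival_le_1[OF c01[OF that]] by simp
    qed
    also have "\<dots> = (n - (\<Sum>k\<in>N. survival f (c N k))) * serial_value (n - 1)"
      using N by (simp add: sum_distrib_right[symmetric] sum_subtractf)
    also have "\<dots> \<le> (n - n * survival f (1 / n)) * serial_value (n - 1)"
      using n
    proof
      assume "n = 2"
      then show ?thesis by (simp add: serial_value_def survival_1)
    next
      assume "n = 3 \<and> antimono_on {0..1} f"
      then have "n * survival f (1 / n) \<le> (\<Sum>k\<in>N. survival f (c N k))"
        using sum_survival_ge[of N "c N"] N c01 c coN by (simp add: valid_cost_shares_def)
      then show ?thesis using serial_value_nonneg by (intro mult_right_mono) auto
    qed
    finally show ?thesis
      using coalition_value_le_serial[OF lc c coN] N(3) by (simp add: reward_eq[OF c] serial)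
  qed
  then show ?thesis
    unfolding is_arg_max_def using largest_unanimous_serial
    by (force simp: largest_unanimous_def not_less)
qed

end

section \<open>The two objectives as instances\<close>

context unit_interval_density
begin

lemma reward_density_consumers: "reward_density f (\<lambda>_ _. 1) (\<lambda>_. 1)"
  by unfold_locales (auto simp: survival_def concave_on_def convex_on_def convex_positive_survival)

lemma reward_density_welfare:
  assumes "welfare_concave f"
  shows "reward_density f (\<lambda>x c. x - c) (conditional_welfare f)"
proof unfold_locales
  have int: "set_integrable lborel {c..1} f" if "c \<in> {0..1}" for c
    by (rule set_integrable_subset[OF set_integrable_density]) (use that in auto)
  have int': "set_integrable lborel {c..1} (\<lambda>x. (x - c) * f x)" if "c \<in> {0..1}" for c
    using that by (intro borel_integrable_atLeastAtMost' continuous_intros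
        continuous_on_subset[OF continuous]) auto
  have welfare_nonneg: "0 \<le> (LINT x:{c..1}|lborel. (x - c) * f x)" if "c \<in> {0..1}" for c
    using that unfolding set_lebesgue_integral_def
    by (intro Bochner_Integration.integral_nonneg) (auto simp: indicator_def nonneg)
  have welfare_le: "(LINT x:{c..1}|lborel. (x - c) * f x) \<le> survival f c" if "c \<in> {0..1}" for c
    unfolding survival_def using that int int'
    by (intro set_integral_mono) (auto simp: mult_left_le_one_le nonneg)
  \<comment> \<open>Where \<open>survival f c = 0\<close>, the quotient is \<open>0\<close> by
    convention, but the integral lies between \<open>0\<close> and \<open>survival f c\<close> and
    so vanishes too.\<close>
  show "(LINT x:{c..1}|lborel. (x - c) * f x) = conditional_welfare f c * survival f c"
    if "c \<in> {0..1}" for c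
    using welfare_nonneg[OF that] welfare_le[OF that]
    by (cases "survival f c = 0") (auto simp: conditional_welfare_def survival_def)
  show "0 \<le> conditional_welfare f c" if "c \<in> {0..1}" for c
    using welfare_nonneg[OF that] survival_nonneg[OF that]
    by (simp add: conditional_welfare_def survival_def)
  show "concave_on positive_survival (conditional_welfare f)"
    using assms by (simp add: welfare_concave_def positive_survival_def survival_def)
qed auto

end

theorem theorem3p5:
  fixes f :: "real \<Rightarrow> real"
  assumes "unit_density f" and "f differentiable_on {0..1}"
  shows
    "(log_concave f \<longrightarrow>
        is_arg_max (expected_consumers 2 f) (largest_unanimous 2) (serial_cost_sharing 2)) \<and>
     (log_concave f \<and> welfare_concave f \<longrightarrow>
        is_arg_max (expected_welfare 2 f) (largest_unanimous 2) (serial_cost_sharing 2)) \<and>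
     (log_concave f \<and> antimono_on {0..1} f \<longrightarrow>
        is_arg_max (expected_consumers 3 f) (largest_unanimous 3) (serial_cost_sharing 3)) \<and>
     (log_concave f \<and> antimono_on {0..1} f \<and> welfare_concave f \<longrightarrow>
        is_arg_max (expected_welfare 3 f) (largest_unanimous 3) (serial_cost_sharing 3))"
proof -
  interpret unit_interval_density f
    using assms by unfold_locales (auto intro: differentiable_imp_continuous_on)
  have consumers: "is_arg_max (expected_consumers n f) (largest_unanimous n) (serial_cost_sharing n)"
    if "n = 2 \<or> n = 3 \<and> antimono_on {0..1} f" "log_concave f" for n
    unfolding expected_consumers_eq_reward
    using reward_density.serial_cost_sharing_optimal[OF reward_density_consumers that] .
  have welfare: "is_arg_max (expected_welfare n f) (largest_unanimous n) (serial_cost_sharing n)"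
    if "n = 2 \<or> n = 3 \<and> antimono_on {0..1} f" "log_concave f" "welfare_concave f" for n
    \<comment> \<open>Welfare was identified with an expected reward only for largest unanimous
      mechanisms, so the rewriting takes place inside \<open>is_arg_max\<close>, where that
      membership is available.\<close>
    using reward_density.serial_cost_sharing_optimal[OF reward_density_welfare[OF that(3)] that(1,2)]
    unfolding is_arg_max_def by (metis expected_welfare_eq_reward)
  show ?thesis using consumers welfare by simp
qed

end
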